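(* Let $q_0,q_1:\mathbb{R}^n\to\mathbb{R}$ be quadratic functions $q_i(x)=x^\top A_i x+2b_i^\top x+c_i$ with $A_i\in\mathbb{R}^{n\times n}$ symmetric, $b_i\in\mathbb{R}^n$, $c_i\in\mathbb{R}$. Suppose that $A_0$ and $A_1$ both have a negative eigenvalue and that there exists $\gamma^*\geq 0$ with $A_0+\gamma^*A_1\succeq 0$. Let $\gamma_-=\min\Gamma$ and $\gamma_+=\max\Gamma$, where $\Gamma=\{\gamma\geq 0: A_0+\gamma A_1\succeq 0\}$ (these exist under the hypotheses). Then $$\overline{\operatorname{conv}}(\mathcal{S})=\overline{\operatorname{conv}}(\mathfrak{S})=\mathcal{S}(\gamma_-)\cap\mathcal{S}(\gamma_+).$$ In particular, $$\inf_{x\in\mathbb{R}^n}\{q_0(x): q_1(x)\leq 0\}=\inf_{x\in\mathbb{R}^n}\max\{q(\gamma_-,x),q(\gamma_+,x)\}.$$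
   Context: For $\gamma\in\mathbb{R}$, $q(\gamma,x):=q_0(x)+\gamma q_1(x)$. The sets are $\mathcal{S}:=\{(x,t)\in\mathbb{R}^{n+1}: q_0(x)\leq t,\ q_1(x)\leq 0\}$, $\mathfrak{S}:=\{(x,t)\in\mathbb{R}^{n+1}: q_0(x)\leq t,\ q_1(x)=0\}$, and for $\gamma\geq 0$, $\mathcal{S}(\gamma):=\{(x,t)\in\mathbb{R}^{n+1}: q(\gamma,x)\leq t\}$. $\overline{\operatorname{conv}}$ denotes closed convex hull. *)

theory Defs
  imports "HOL-Analysis.Analysis"
begin

definition quad :: "real^'n^'n \<Rightarrow> real^'n \<Rightarrow> real \<Rightarrow> real^'n \<Rightarrow> real" where
  "quad A b c x = x \<bullet> (A *v x) + 2 * (b \<bullet> x) + c"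

definition eigenvalue :: "real^'n^'n \<Rightarrow> real \<Rightarrow> bool" where
  "eigenvalue A k \<longleftrightarrow> (\<exists>v. v \<noteq> 0 \<and> A *v v = k *\<^sub>R v)"

definition pos_semidef :: "real^'n^'n \<Rightarrow> bool" where
  "pos_semidef A \<longleftrightarrow> transpose A = A \<and> (\<forall>x. 0 \<le> x \<bullet> (A *v x))"

definition psd_params :: "real^'n^'n \<Rightarrow> real^'n^'n \<Rightarrow> real set" where
  "psd_params A0 A1 = {\<gamma>. 0 \<le> \<gamma> \<and> pos_semidef (A0 + \<gamma> *\<^sub>R A1)}"

text \<open>\<^const>\<open>Least\<close> and \<^const>\<open>Greatest\<close> denote an attained minimum/maximum, but are
  unspecified if none exists; attainment therefore has to be stated wherever they are used.\<close>

definition gamma_minus :: "real^'n^'n \<Rightarrow> real^'n^'n \<Rightarrow> real" where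
  "gamma_minus A0 A1 = (LEAST \<gamma>. \<gamma> \<in> psd_params A0 A1)"

definition gamma_plus :: "real^'n^'n \<Rightarrow> real^'n^'n \<Rightarrow> real" where
  "gamma_plus A0 A1 = (GREATEST \<gamma>. \<gamma> \<in> psd_params A0 A1)"

definition q_comb :: "(real^'n \<Rightarrow> real) \<Rightarrow> (real^'n \<Rightarrow> real) \<Rightarrow> real \<Rightarrow> real^'n \<Rightarrow> real" where
  "q_comb q0 q1 \<gamma> x = q0 x + \<gamma> * q1 x"

text \<open>Points of the \<open>(n+1)\<close>-dimensional space are pairs \<open>(x, t)\<close>.\<close>

definition S_le :: "(real^'n \<Rightarrow> real) \<Rightarrow> (real^'n \<Rightarrow> real) \<Rightarrow> ((real^'n) \<times> real) set" where
  "S_le q0 q1 = {(x, t). q0 x \<le> t \<and> q1 x \<le> 0}"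

definition S_eq :: "(real^'n \<Rightarrow> real) \<Rightarrow> (real^'n \<Rightarrow> real) \<Rightarrow> ((real^'n) \<times> real) set" where
  "S_eq q0 q1 = {(x, t). q0 x \<le> t \<and> q1 x = 0}"

definition S_gamma ::
    "(real^'n \<Rightarrow> real) \<Rightarrow> (real^'n \<Rightarrow> real) \<Rightarrow> real \<Rightarrow> ((real^'n) \<times> real) set" where
  "S_gamma q0 q1 \<gamma> = {(x, t). q_comb q0 q1 \<gamma> x \<le> t}"

end

theory Submission
  imports Defs
begin

text \<open>The right-hand side is closed and convex and contains \<open>S_le\<close>. Conversely, let \<open>(x, t)\<close> lie in
  it with \<open>q1 x > 0\<close>. For every \<open>\<gamma> > \<gamma>p\<close> there is a direction \<open>v\<close> with \<open>v \<bullet> (A0 + \<gamma> A1) v < 0\<close>, hence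
  also \<open>v \<bullet> A1 v < 0\<close>. So \<open>x\<close> lies between two zeros of \<open>q1\<close> on the line through \<open>x\<close> in direction
  \<open>v\<close>; at these zeros \<open>q0\<close> agrees with \<open>q(\<gamma>, _)\<close>, which is concave on the line. Thus
  \<open>(x, q(\<gamma>, x))\<close> and every point above it are in the convex hull of \<open>S_eq\<close>, and
  \<open>\<gamma> \<rightarrow> \<gamma>p\<close> finishes this case. The case \<open>q1 x < 0\<close> is symmetric, with \<open>\<gamma> \<rightarrow> \<gamma>m\<close> from below; there
  the negative eigenvalue of \<open>A0\<close> guarantees \<open>\<gamma>m > 0\<close>.\<close>

section \<open>Real quadratics and quadratic functions restricted to lines\<close>

text \<open>Opposite signs of \<open>a\<close> and \<open>c\<close> push the reduced discriminant
  above \<open>\<beta>\<^sup>2\<close>, so its root \<open>r\<close> exceeds the absolute value of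
  \<open>\<beta>\<close> and the two solutions straddle 0.\<close>

lemma quadratic_roots_opposite_signs:
  fixes a \<beta> c :: real
  assumes "a * c < 0"
  obtains s1 s2 where "s1 < 0" "0 < s2"
    "a * s1\<^sup>2 + 2 * \<beta> * s1 + c = 0" "a * s2\<^sup>2 + 2 * \<beta> * s2 + c = 0"
proof -
  define r where "r = sqrt (\<beta>\<^sup>2 - a * c)"
  have a: "a \<noteq> 0" using assms by auto
  have r2: "r\<^sup>2 = \<beta>\<^sup>2 - a * c"
    using assms unfolding r_def by (simp add: less_imp_le[OF less_le_trans[OF _ zero_le_power2]])
  have "\<bar>\<beta>\<bar> = sqrt (\<beta>\<^sup>2)" by simp
  also have "\<dots> < r" unfolding r_def using assms by (intro real_sqrt_less_mono) simp
  finally have r: "\<bar>\<beta>\<bar> < r" .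
  have root: "a * ((e - \<beta>) / a)\<^sup>2 + 2 * \<beta> * ((e - \<beta>) / a) + c = 0" if "e\<^sup>2 = r\<^sup>2" for e
  proof -
    have "a * (a * ((e - \<beta>) / a)\<^sup>2 + 2 * \<beta> * ((e - \<beta>) / a) + c)
        = (e - \<beta>)\<^sup>2 + 2 * \<beta> * (e - \<beta>) + a * c"
      using a by (simp add: field_simps power2_eq_square)
    also have "\<dots> = e\<^sup>2 - \<beta>\<^sup>2 + a * c" by (simp add: algebra_simps power2_eq_square)
    also have "\<dots> = 0" using that r2 by simp
    finally show ?thesis using a by simp
  qed
  show thesis
  \<comment> \<open>The sign of \<open>a\<close> decides which of the two roots is the negative
    one.\<close>
  proof (cases "a > 0")
    case True
    then show thesis using r root[of r] root[of "- r"]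
      by (intro that[of "(- r - \<beta>) / a" "(r - \<beta>) / a"]) (auto simp: divide_simps)
  next
    case False
    then show thesis using a r root[of r] root[of "- r"]
      by (intro that[of "(r - \<beta>) / a" "(- r - \<beta>) / a"]) (auto simp: divide_simps)
  qed
qed

lemma inner_matrix_vector_symmetric:
  fixes A :: "real^'n^'n"
  assumes "transpose A = A"
  shows "x \<bullet> (A *v y) = y \<bullet> (A *v x)"
  by (metis assms dot_lmul_matrix inner_commute transpose_matrix_vector)

lemma inner_matrix_add_scaleR:
  fixes A B :: "real^'n^'n"
  shows "x \<bullet> ((A + k *\<^sub>R B) *v y) = x \<bullet> (A *v y) + k * (x \<bullet> (B *v y))"
  by (simp add: matrix_vector_mult_add_rdistrib inner_add_right flip: scaleR_matrix_vector_assoc)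

text \<open>Symmetry of \<open>A\<close> merges the two cross terms into one linear
  coefficient.\<close>

lemma quad_on_line:
  fixes A :: "real^'n^'n"
  assumes "transpose A = A"
  shows "quad A b c (x + s *\<^sub>R v)
    = (v \<bullet> (A *v v)) * s\<^sup>2 + 2 * (v \<bullet> (A *v x) + b \<bullet> v) * s + quad A b c x"
  using inner_matrix_vector_symmetric[OF assms, of x v]
  by (simp add: quad_def matrix_vector_right_distrib matrix_vector_mult_scaleR inner_simps
      algebra_simps power2_eq_square)

lemma q_comb_quad:
  fixes A0 A1 :: "real^'n^'n"
  shows "q_comb (quad A0 b0 c0) (quad A1 b1 c1) \<gamma>
    = quad (A0 + \<gamma> *\<^sub>R A1) (b0 + \<gamma> *\<^sub>R b1) (c0 + \<gamma> * c1)"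
  by (rule ext) (simp add: q_comb_def quad_def inner_matrix_add_scaleR inner_add_left distrib_left)

lemma transpose_add_scaleR:
  fixes A B :: "real^'n^'n"
  assumes "transpose A = A" "transpose B = B"
  shows "transpose (A + k *\<^sub>R B) = A + k *\<^sub>R B"
  using assms by (simp add: transpose_def vec_eq_iff)

section \<open>Points of the convex hull of \<open>S_eq\<close>, and limits of them\<close>

text \<open>Assumption \<open>opp\<close> is a product so that both signs of \<open>q1\<close> at
  \<open>x\<close> are served at once. Concavity along the line enters through an explicit convex
  combination of two lifted points.\<close>

lemma epigraph_point_in_hull_S_eq:
  fixes A0 A1 :: "real^'n^'n"
  assumes sym: "transpose A0 = A0" "transpose A1 = A1"
    and neg: "v \<bullet> (A0 *v v) + \<gamma> * (v \<bullet> (A1 *v v)) \<le> 0"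
    and opp: "(v \<bullet> (A1 *v v)) * quad A1 b1 c1 x < 0"
    and t: "q_comb (quad A0 b0 c0) (quad A1 b1 c1) \<gamma> x \<le> t"
  shows "(x, t) \<in> convex hull (S_eq (quad A0 b0 c0) (quad A1 b1 c1))"
proof -
  let ?q0 = "quad A0 b0 c0" and ?q1 = "quad A1 b1 c1"
  let ?h = "q_comb ?q0 ?q1 \<gamma>"
  define \<alpha> where "\<alpha> = v \<bullet> ((A0 + \<gamma> *\<^sub>R A1) *v v)"
  define \<delta> where "\<delta> = v \<bullet> ((A0 + \<gamma> *\<^sub>R A1) *v x) + (b0 + \<gamma> *\<^sub>R b1) \<bullet> v"
  obtain s1 s2 where s: "s1 < 0" "0 < s2"
    and q1: "?q1 (x + s1 *\<^sub>R v) = 0" "?q1 (x + s2 *\<^sub>R v) = 0"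
    using quadratic_roots_opposite_signs[OF opp] by (metis quad_on_line[OF sym(2)])
  have line: "?h (x + s *\<^sub>R v) = \<alpha> * s\<^sup>2 + 2 * \<delta> * s + ?h x" for s
    unfolding q_comb_quad \<alpha>_def \<delta>_def by (rule quad_on_line[OF transpose_add_scaleR[OF sym]])
  \<comment> \<open>The chord of \<open>?h\<close> between the two zeros has height
    \<open>?h x - \<alpha> * (s1 * s2)\<close> over \<open>x\<close>; lifting both ends by
    \<open>e\<close> makes this exactly \<open>t\<close>.\<close>
  define e where "e = t - ?h x + \<alpha> * (s1 * s2)"
  have "0 \<le> \<alpha> * (s1 * s2)"
    using neg s unfolding \<alpha>_def inner_matrix_add_scaleR by (intro mult_nonpos_nonpos) (auto simp: mult_le_0_iff)
  then have e: "0 \<le> e" using t unfolding e_def by simp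
  \<comment> \<open>The weight for which the parameters \<open>s1\<close> and \<open>s2\<close>
    average to 0, the parameter of \<open>x\<close>.\<close>
  define w where "w = - s1 / (s2 - s1)"
  define p where "p s = (x + s *\<^sub>R v, ?h (x + s *\<^sub>R v) + e)" for s
  have w: "0 \<le> w" "w \<le> 1" using s by (auto simp: w_def field_simps)
  have p: "p s1 \<in> S_eq ?q0 ?q1" "p s2 \<in> S_eq ?q0 ?q1"
    using q1 e by (auto simp: S_eq_def p_def q_comb_def)
  have mean: "(1 - w) * s1 + w * s2 = 0"
    using s by (simp add: w_def field_simps)
  \<comment> \<open>Both parameters satisfy \<open>s\<^sup>2 = (s1 + s2) * s - s1 * s2\<close>;
    averaging removes the linear term because the mean is 0.\<close>
  have square: "(1 - w) * s1\<^sup>2 + w * s2\<^sup>2 = - (s1 * s2)"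
  proof -
    have "(1 - w) * s1\<^sup>2 + w * s2\<^sup>2 = ((1 - w) * s1 + w * s2) * (s1 + s2) - s1 * s2"
      by (simp add: algebra_simps power2_eq_square)
    then show ?thesis using mean by simp
  qed
  have "(1 - w) *\<^sub>R p s1 + w *\<^sub>R p s2 = (x, t)"
  proof -
    have "(1 - w) *\<^sub>R (x + s1 *\<^sub>R v) + w *\<^sub>R (x + s2 *\<^sub>R v)
        = x + ((1 - w) * s1 + w * s2) *\<^sub>R v"
      by (simp add: algebra_simps)
    moreover have "(1 - w) * (?h (x + s1 *\<^sub>R v) + e) + w * (?h (x + s2 *\<^sub>R v) + e)
        = \<alpha> * ((1 - w) * s1\<^sup>2 + w * s2\<^sup>2) + 2 * \<delta> * ((1 - w) * s1 + w * s2) + ?h x + e"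
      by (simp add: line algebra_simps)
    ultimately show ?thesis by (simp add: p_def mean square e_def)
  qed
  moreover have "(1 - w) *\<^sub>R p s1 + w *\<^sub>R p s2 \<in> convex hull (S_eq ?q0 ?q1)"
    using w p by (intro convexD[OF convex_convex_hull]) (auto intro: hull_inc)
  ultimately show ?thesis by simp
qed

text \<open>Used with \<open>d\<close> as the rate at which the height over \<open>x\<close> changes
  when the parameter is perturbed by a multiple of \<open>1 / (n + 1)\<close>.\<close>

lemma vertical_limit_in_closure:
  fixes x :: "'a::real_normed_vector" and t d :: real
  assumes "\<And>n. (x, t + d * inverse (real (Suc n))) \<in> C"
  shows "(x, t) \<in> closure C"
proof -
  have "(\<lambda>n. (x, t + d * inverse (real (Suc n)))) \<longlonglongrightarrow> (x, t + d * 0)"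
    by (intro tendsto_intros LIMSEQ_inverse_real_of_nat)
  then have "(\<lambda>n. (x, t + d * inverse (real (Suc n)))) \<longlonglongrightarrow> (x, t)" by simp
  with assms show ?thesis
    unfolding closure_sequential
    by (intro exI[of _ "\<lambda>n. (x, t + d * inverse (real (Suc n)))"]) blast
qed

section \<open>The set of parameters giving a positive semidefinite combination\<close>

lemma eigenvalue_negative_direction:
  fixes A :: "real^'n^'n"
  assumes "eigenvalue A k" "k < 0"
  obtains v where "v \<bullet> (A *v v) < 0"
proof -
  from assms obtain v where "v \<noteq> 0" "A *v v = k *\<^sub>R v" by (auto simp: eigenvalue_def)
  then have "v \<bullet> (A *v v) < 0" using assms(2) by (simp add: mult_neg_pos)
  then show thesis by (rule that)
qed

text \<open>Symmetry of the combination is automatic, which leaves one inequality, affine in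
  \<open>\<gamma>\<close>, for each direction.\<close>

lemma psd_params_iff:
  fixes A0 A1 :: "real^'n^'n"
  assumes "transpose A0 = A0" "transpose A1 = A1"
  shows "\<gamma> \<in> psd_params A0 A1
    \<longleftrightarrow> 0 \<le> \<gamma> \<and> (\<forall>x. 0 \<le> x \<bullet> (A0 *v x) + \<gamma> * (x \<bullet> (A1 *v x)))"
  using transpose_add_scaleR[OF assms, of \<gamma>]
  by (simp add: psd_params_def pos_semidef_def inner_matrix_add_scaleR inner_simps)

text \<open>The affine inequalities make the set closed, and the one for \<open>v\<close> bounds it
  above. Compactness then yields an attained minimum and maximum once the set is nonempty.\<close>

lemma compact_psd_params:
  fixes A0 A1 :: "real^'n^'n"
  assumes sym: "transpose A0 = A0" "transpose A1 = A1"
    and "v \<bullet> (A1 *v v) < 0"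
  shows "compact (psd_params A0 A1)"
proof -
  have eq: "psd_params A0 A1
      = {0..} \<inter> (\<Inter>x. {\<gamma>. 0 \<le> x \<bullet> (A0 *v x) + \<gamma> * (x \<bullet> (A1 *v x))})"
    using psd_params_iff[OF sym] by auto
  have "closed (psd_params A0 A1)"
    unfolding eq
    by (intro closed_Int closed_INT ballI closed_Collect_le continuous_intros)
  moreover have "psd_params A0 A1 \<subseteq> {0..(v \<bullet> (A0 *v v)) / - (v \<bullet> (A1 *v v))}"
  proof
    fix \<gamma> assume "\<gamma> \<in> psd_params A0 A1"
    then have "0 \<le> \<gamma>" "0 \<le> v \<bullet> (A0 *v v) + \<gamma> * (v \<bullet> (A1 *v v))"
      using psd_params_iff[OF sym] by auto
    then show "\<gamma> \<in> {0..(v \<bullet> (A0 *v v)) / - (v \<bullet> (A1 *v v))}"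
      using assms(3) by (simp add: pos_le_divide_eq field_simps)
  qed
  ultimately show ?thesis
    by (meson bounded_closed_interval bounded_subset compact_eq_bounded_closed)
qed

section \<open>Convexity and closedness of the right-hand side\<close>

text \<open>On a segment the convexity gap is exactly \<open>\<alpha> * (s * (1 - s))\<close>, where
  \<open>\<alpha>\<close> is the value of the quadratic form at \<open>y - x\<close>.\<close>

lemma psd_imp_convex_quad:
  fixes A :: "real^'n^'n"
  assumes "pos_semidef A"
  shows "convex_on UNIV (quad A b c)"
proof (rule convex_onI)
  fix s :: real and x y :: "real^'n"
  assume s: "0 < s" "s < 1"
  have sym: "transpose A = A" using assms by (simp add: pos_semidef_def)
  have xy: "(1 - s) *\<^sub>R x + s *\<^sub>R y = x + s *\<^sub>R (y - x)" by (simp add: algebra_simps)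
  define \<alpha> where "\<alpha> = (y - x) \<bullet> (A *v (y - x))"
  define \<beta> where "\<beta> = (y - x) \<bullet> (A *v x) + b \<bullet> (y - x)"
  have line: "quad A b c (x + r *\<^sub>R (y - x)) = \<alpha> * r\<^sup>2 + 2 * \<beta> * r + quad A b c x" for r
    unfolding \<alpha>_def \<beta>_def by (rule quad_on_line[OF sym])
  have "quad A b c y = \<alpha> + 2 * \<beta> + quad A b c x" using line[of 1] by simp
  then have "(1 - s) * quad A b c x + s * quad A b c y - quad A b c (x + s *\<^sub>R (y - x))
      = \<alpha> * (s * (1 - s))"
    unfolding line by (simp add: algebra_simps power2_eq_square)
  also have "\<dots> \<ge> 0" using assms s by (simp add: pos_semidef_def \<alpha>_def)
  finally show "quad A b c ((1 - s) *\<^sub>R x + s *\<^sub>R y) \<le> (1 - s) * quad A b c x + s * quad A b c y"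
    unfolding xy by simp
qed simp

lemma continuous_on_quad [continuous_intros]:
  fixes A :: "real^'n^'n"
  assumes "continuous_on S f"
  shows "continuous_on S (\<lambda>z. quad A b c (f z))"
  unfolding quad_def
  by (intro continuous_intros assms
      continuous_on_compose2[OF matrix_vector_mult_linear_continuous_on assms subset_UNIV])

lemma S_gamma_closed_convex:
  fixes A0 A1 :: "real^'n^'n"
  assumes "\<gamma> \<in> psd_params A0 A1"
  shows "closed (S_gamma (quad A0 b0 c0) (quad A1 b1 c1) \<gamma>)"
    and "convex (S_gamma (quad A0 b0 c0) (quad A1 b1 c1) \<gamma>)"
proof -
  let ?q = "quad (A0 + \<gamma> *\<^sub>R A1) (b0 + \<gamma> *\<^sub>R b1) (c0 + \<gamma> * c1)"
  have eq: "S_gamma (quad A0 b0 c0) (quad A1 b1 c1) \<gamma> = {z. ?q (fst z) \<le> snd z}"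
    by (auto simp: S_gamma_def q_comb_quad)
  show "closed (S_gamma (quad A0 b0 c0) (quad A1 b1 c1) \<gamma>)"
    unfolding eq by (intro closed_Collect_le continuous_intros)
  have "convex_on UNIV ?q"
    using assms by (intro psd_imp_convex_quad) (simp add: psd_params_def)
  then have "convex (epigraph UNIV ?q)" by (simp add: convex_epigraph)
  then show "convex (S_gamma (quad A0 b0 c0) (quad A1 b1 c1) \<gamma>)"
    unfolding eq by (simp add: epigraph_def)
qed

lemma S_le_subset_S_gamma:
  assumes "0 \<le> \<gamma>"
  shows "S_le q0 q1 \<subseteq> S_gamma q0 q1 \<gamma>"
  using assms by (auto simp: S_le_def S_gamma_def q_comb_def intro: order_trans[rotated]
      dest: mult_nonneg_nonpos[OF assms])

section \<open>Attained parameters, the hull identity and the two infima\<close>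

text \<open>The first four conjuncts record attainment, which gives \<open>LEAST\<close> and
  \<open>GREATEST\<close> their meaning. The infima live in \<open>ereal\<close>, so no lower bound
  on \<open>q0\<close> is presupposed.\<close>

theorem theorem2:
  fixes A0 A1 :: "real^'n^'n" and b0 b1 :: "real^'n" and c0 c1 :: real
    and q0 q1 :: "real^'n \<Rightarrow> real" and \<Gamma> :: "real set" and \<gamma>m \<gamma>p :: real
  defines "q0 \<equiv> quad A0 b0 c0" and "q1 \<equiv> quad A1 b1 c1"
    and "\<Gamma> \<equiv> psd_params A0 A1"
    and "\<gamma>m \<equiv> gamma_minus A0 A1" and "\<gamma>p \<equiv> gamma_plus A0 A1"
  assumes "transpose A0 = A0" and "transpose A1 = A1"
    and "\<exists>k. eigenvalue A0 k \<and> k < 0"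
    and "\<exists>k. eigenvalue A1 k \<and> k < 0"
    and "\<exists>\<gamma>\<ge>0. pos_semidef (A0 + \<gamma> *\<^sub>R A1)"
  shows "\<gamma>m \<in> \<Gamma> \<and> (\<forall>\<gamma>\<in>\<Gamma>. \<gamma>m \<le> \<gamma>) \<and> \<gamma>p \<in> \<Gamma> \<and> (\<forall>\<gamma>\<in>\<Gamma>. \<gamma> \<le> \<gamma>p)
    \<and> closure (convex hull (S_le q0 q1)) = closure (convex hull (S_eq q0 q1))
    \<and> closure (convex hull (S_eq q0 q1)) = S_gamma q0 q1 \<gamma>m \<inter> S_gamma q0 q1 \<gamma>p
    \<and> (INF x\<in>{x. q1 x \<le> 0}. ereal (q0 x))
        = (INF x. ereal (max (q_comb q0 q1 \<gamma>m x) (q_comb q0 q1 \<gamma>p x)))"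
proof -
  note sym = \<open>transpose A0 = A0\<close> \<open>transpose A1 = A1\<close>
  obtain v0 where v0: "v0 \<bullet> (A0 *v v0) < 0"
    using \<open>\<exists>k. eigenvalue A0 k \<and> k < 0\<close> eigenvalue_negative_direction by metis
  obtain v1 where v1: "v1 \<bullet> (A1 *v v1) < 0"
    using \<open>\<exists>k. eigenvalue A1 k \<and> k < 0\<close> eigenvalue_negative_direction by metis
  have comp: "compact \<Gamma>" unfolding \<Gamma>_def by (rule compact_psd_params[OF sym v1])
  have ne: "\<Gamma> \<noteq> {}"
    using \<open>\<exists>\<gamma>\<ge>0. pos_semidef (A0 + \<gamma> *\<^sub>R A1)\<close> by (auto simp: \<Gamma>_def psd_params_def)
  obtain l where l: "l \<in> \<Gamma>" "\<And>\<gamma>. \<gamma> \<in> \<Gamma> \<Longrightarrow> l \<le> \<gamma>"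
    using compact_attains_inf[OF comp ne] by auto
  obtain u where u: "u \<in> \<Gamma>" "\<And>\<gamma>. \<gamma> \<in> \<Gamma> \<Longrightarrow> \<gamma> \<le> u"
    using compact_attains_sup[OF comp ne] by auto
  have "\<gamma>m = l"
    unfolding \<gamma>m_def gamma_minus_def using l by (intro Least_equality) (auto simp: \<Gamma>_def)
  then have m: "\<gamma>m \<in> \<Gamma>" "\<And>\<gamma>. \<gamma> \<in> \<Gamma> \<Longrightarrow> \<gamma>m \<le> \<gamma>" using l by auto
  have "\<gamma>p = u"
    unfolding \<gamma>p_def gamma_plus_def using u by (intro Greatest_equality) (auto simp: \<Gamma>_def)
  then have p: "\<gamma>p \<in> \<Gamma>" "\<And>\<gamma>. \<gamma> \<in> \<Gamma> \<Longrightarrow> \<gamma> \<le> \<gamma>p" using u by auto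
  have mem: "\<gamma> \<in> \<Gamma> \<longleftrightarrow> 0 \<le> \<gamma> \<and> (\<forall>x. 0 \<le> x \<bullet> (A0 *v x) + \<gamma> * (x \<bullet> (A1 *v x)))" for \<gamma>
    unfolding \<Gamma>_def by (rule psd_params_iff[OF sym])
  have m0: "0 < \<gamma>m"
  proof -
    have "0 \<notin> \<Gamma>" using v0 by (auto simp: mem not_le)
    then show ?thesis using m(1) mem[of \<gamma>m] by (cases "\<gamma>m = 0") auto
  qed
  have p0: "0 \<le> \<gamma>p" using p(1) mem by blast
  let ?R = "S_gamma q0 q1 \<gamma>m \<inter> S_gamma q0 q1 \<gamma>p"
  have sub: "S_eq q0 q1 \<subseteq> S_le q0 q1" by (auto simp: S_eq_def S_le_def)
  have le_R: "S_le q0 q1 \<subseteq> ?R" by (intro Int_greatest S_le_subset_S_gamma less_imp_le[OF m0] p0)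
  have "closed ?R" "convex ?R"
    using S_gamma_closed_convex m(1) p(1) unfolding q0_def q1_def \<Gamma>_def
    by (auto intro!: closed_Int convex_Int)
  then have hull_R: "closure (convex hull (S_le q0 q1)) \<subseteq> ?R"
    using le_R by (intro closure_minimal hull_minimal)
  have R_hull: "?R \<subseteq> closure (convex hull (S_eq q0 q1))"
  proof
    fix z assume z: "z \<in> ?R"
    obtain x t where xt: "z = (x, t)" by (cases z)
    have tm: "q0 x + \<gamma>m * q1 x \<le> t" and tp: "q0 x + \<gamma>p * q1 x \<le> t"
      using z by (auto simp: xt S_gamma_def q_comb_def)
    consider "q1 x = 0" | "q1 x > 0" | "q1 x < 0" by linarith
    then have "(x, t) \<in> closure (convex hull (S_eq q0 q1))"
    proof cases
      case 1
      then have "(x, t) \<in> S_eq q0 q1" using tm by (simp add: S_eq_def)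
      then show ?thesis by (meson closure_subset hull_inc subsetD)
    next
      case 2
      show ?thesis
      \<comment> \<open>Raising the parameter from \<open>\<gamma>p\<close> by
        \<open>1 / (n + 1)\<close> raises the combination at \<open>x\<close> by
        \<open>q1 x / (n + 1)\<close>.\<close>
      proof (rule vertical_limit_in_closure[where d = "q1 x"])
        fix n
        define \<gamma> where "\<gamma> = \<gamma>p + inverse (real (Suc n))"
        have g: "\<gamma>p < \<gamma>" by (simp add: \<gamma>_def)
        then have "\<gamma> \<notin> \<Gamma>" "0 \<le> \<gamma>" using p p0 by fastforce+
        then obtain v where v: "v \<bullet> (A0 *v v) + \<gamma> * (v \<bullet> (A1 *v v)) < 0"
          by (auto simp: mem not_le)
        \<comment> \<open>Subtracting the form at \<open>\<gamma>p\<close> from the one at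
          \<open>\<gamma>\<close> isolates the sign of the \<open>A1\<close> term.\<close>
        have "0 \<le> v \<bullet> (A0 *v v) + \<gamma>p * (v \<bullet> (A1 *v v))" using p(1) mem by blast
        then have "(\<gamma> - \<gamma>p) * (v \<bullet> (A1 *v v)) < 0" using v by (simp add: algebra_simps)
        then have "v \<bullet> (A1 *v v) < 0" using g by (simp add: mult_less_0_iff)
        then have "(v \<bullet> (A1 *v v)) * q1 x < 0" using 2 by (simp add: mult_neg_pos)
        then show "(x, t + q1 x * inverse (real (Suc n))) \<in> convex hull (S_eq q0 q1)"
          using v tp unfolding q0_def q1_def
          by (intro epigraph_point_in_hull_S_eq[OF sym, of v \<gamma>])
            (auto simp: q_comb_def \<gamma>_def algebra_simps)
      qed
    next
      case 3
      show ?thesis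
      proof (rule vertical_limit_in_closure[where d = "- \<gamma>m * q1 x"])
        fix n
        \<comment> \<open>The factor \<open>\<gamma>m\<close> keeps \<open>\<gamma>\<close>
          nonnegative even for \<open>n = 0\<close>. Hence \<open>\<gamma> \<notin> \<Gamma>\<close>
          must come from a direction of negative curvature, not from the sign of
          \<open>\<gamma>\<close>.\<close>
        define \<gamma> where "\<gamma> = \<gamma>m - \<gamma>m * inverse (real (Suc n))"
        have g: "\<gamma> < \<gamma>m" using m0 by (simp add: \<gamma>_def)
        then have "\<gamma> \<notin> \<Gamma>" using m by fastforce
        moreover have "0 \<le> \<gamma>" using m0 by (simp add: \<gamma>_def field_simps)
        ultimately obtain v where v: "v \<bullet> (A0 *v v) + \<gamma> * (v \<bullet> (A1 *v v)) < 0"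
          by (auto simp: mem not_le)
        have "0 \<le> v \<bullet> (A0 *v v) + \<gamma>m * (v \<bullet> (A1 *v v))" using m(1) mem by blast
        then have "0 < (\<gamma>m - \<gamma>) * (v \<bullet> (A1 *v v))" using v by (simp add: algebra_simps)
        then have "0 < v \<bullet> (A1 *v v)" using g by (simp add: zero_less_mult_iff)
        then have "(v \<bullet> (A1 *v v)) * q1 x < 0" using 3 by (simp add: mult_pos_neg)
        then show "(x, t + - \<gamma>m * q1 x * inverse (real (Suc n))) \<in> convex hull (S_eq q0 q1)"
          using v tm unfolding q0_def q1_def
          by (intro epigraph_point_in_hull_S_eq[OF sym, of v \<gamma>])
            (auto simp: q_comb_def \<gamma>_def algebra_simps)
      qed
    qed
    then show "z \<in> closure (convex hull (S_eq q0 q1))" using xt by simp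
  qed
  have eq_le: "closure (convex hull (S_eq q0 q1)) \<subseteq> closure (convex hull (S_le q0 q1))"
    by (intro closure_mono hull_mono sub)
  let ?I = "INF x\<in>{x. q1 x \<le> 0}. ereal (q0 x)"
  let ?M = "\<lambda>x. max (q_comb q0 q1 \<gamma>m x) (q_comb q0 q1 \<gamma>p x)"
  have "?I = (INF x. ereal (?M x))"
  proof (rule antisym)
    show "?I \<le> (INF x. ereal (?M x))"
    proof (rule INF_greatest, rule ccontr)
      fix x
      assume "\<not> ?I \<le> ereal (?M x)"
      then obtain r where r: "ereal (?M x) < ereal r" "ereal r < ?I"
        using ereal_dense2[of "ereal (?M x)" ?I] by (auto simp: not_le)
      \<comment> \<open>This closed half-space contains \<open>S_le\<close>, hence its closed convex
        hull and so \<open>?R\<close>; yet the point \<open>(x, ?M x)\<close> of \<open>?R\<close>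
        lies strictly below it.\<close>
      let ?H = "{z :: (real^'n) \<times> real. r \<le> snd z}"
      have "S_le q0 q1 \<subseteq> ?H"
      proof
        fix z assume "z \<in> S_le q0 q1"
        then have z: "q0 (fst z) \<le> snd z" "q1 (fst z) \<le> 0" by (auto simp: S_le_def)
        then have "ereal r < ereal (q0 (fst z))"
          using r(2) by (meson INF_lower less_le_trans mem_Collect_eq)
        then show "z \<in> ?H" using z by simp
      qed
      moreover have "closed ?H" by (intro closed_Collect_le continuous_intros)
      moreover have "convex ?H"
      proof -
        have "?H = snd -` {r..}" by auto
        then show ?thesis by (simp add: convex_linear_vimage[OF linear_snd])
      qed
      ultimately have "closure (convex hull (S_le q0 q1)) \<subseteq> ?H"
        by (intro closure_minimal hull_minimal)
      moreover have "(x, ?M x) \<in> ?R" by (simp add: S_gamma_def)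
      ultimately have "(x, ?M x) \<in> ?H" using R_hull eq_le by blast
      then show False using r(1) by (auto simp: le_max_iff_disj)
    qed
    show "(INF x. ereal (?M x)) \<le> ?I"
    proof (rule INF_greatest)
      fix x assume "x \<in> {x. q1 x \<le> 0}"
      then have "(x, q0 x) \<in> S_le q0 q1" by (simp add: S_le_def)
      then have "ereal (?M x) \<le> ereal (q0 x)" using le_R by (auto simp: S_gamma_def)
      then show "(INF x. ereal (?M x)) \<le> ereal (q0 x)" by (meson INF_lower2 UNIV_I)
    qed
  qed
  \<comment> \<open>The inclusions form a cycle: hull of \<open>S_eq\<close>, hull of
    \<open>S_le\<close>, \<open>?R\<close>, and back.\<close>
  then show ?thesis using m p hull_R R_hull eq_le by blast
qed

end
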